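(* (a) For every Experiment A with a finite number of outcomes, there is an Experiment B, with outcomes having non-zero probabilities between every pair of outcomes of Experiment A, that is strictly predicted by Experiment A. (b) For every Experiment B with a finite number of outcomes, there is an Experiment A, with outcomes having non-zero probabilities between every pair of outcomes of Experiment B and with the outcomes of A and B interwoven, that strictly predicts Experiment B.
   Context: An experiment here is a real random variable; its possible values are its outcomes. Let $X$ be the result of a single trial of Experiment A and $Y$ the result of a single trial of Experiment B, with $X$ and $Y$ independent. A pointer is a real number $p$. Alice observes $X$ but not $Y$; she guesses "$X>Y$" if $p<X$ and guesses "$Y>X$" if $p>X$ (no guess is specified when $p=X$). $P(SG)$ denotes the probability that, with pointer $p$, her guess is successful; ties $X=Y$ are either ignored or counted as successes with probability $\tfrac12$. Experiment A strictly predicts Experiment B if every choice of pointer results in $P(SG)\ge\tfrac12$ and for some choice of pointer $P(SG)>\tfrac12$. The outcomes of A and B are interwoven if some of the outcomes of Experiment A are between outcomes of Experiment B, and vice versa.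
   Formalization: The given experiment is required to have at least two outcomes; with a single outcome (a) fails because the success probabilities for pointers below and above it sum to 1, and (b) fails because nothing lies between outcomes of B. *)

theory Defs
  imports "HOL-Probability.Probability"
begin

text \<open>An experiment is represented by the law of its real random variable, i.e. by a
  measure satisfying \<^locale>\<open>real_distribution\<close>. For independent \<open>X\<close> and \<open>Y\<close> with laws \<open>A\<close>
  and \<open>B\<close>, the joint law of \<open>(X, Y)\<close> is the product measure \<open>A \<Otimes>\<^sub>M B\<close>.\<close>

text \<open>The possible values form the support of the law. For an experiment with finitely many
  outcomes these are exactly the values taken with non-zero probability.\<close>

definition outcomes :: "real measure \<Rightarrow> real set" where
  "outcomes A = {x. \<forall>e>0. measure A (ball x e) > 0}"

text \<open>Two conventions for the ties \<open>X = Y\<close>: tied trials are disregarded (probabilities are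
  conditional on \<open>X \<noteq> Y\<close>), or a tie counts as a success with probability one half.\<close>

datatype tie_rule = Ties_Ignored | Ties_Half

text \<open>With pointer \<open>p\<close> and observation \<open>x\<close>, Alice guesses ``\<open>X > Y\<close>'' or ``\<open>Y > X\<close>''. The rule
  does not say what happens for \<open>x = p\<close>; the parameter \<open>g\<close> is her guess there
  (\<open>True\<close> means ``\<open>X > Y\<close>'').\<close>

definition guesses_X_larger :: "bool \<Rightarrow> real \<Rightarrow> real \<Rightarrow> bool" where
  "guesses_X_larger g p x \<longleftrightarrow> p < x \<or> (p = x \<and> g)"

definition correct_guess :: "bool \<Rightarrow> real \<Rightarrow> real \<Rightarrow> real \<Rightarrow> bool" where
  "correct_guess g p x y \<longleftrightarrow> (if guesses_X_larger g p x then x > y else y > x)"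

fun prob_SG :: "tie_rule \<Rightarrow> real measure \<Rightarrow> real measure \<Rightarrow> bool \<Rightarrow> real \<Rightarrow> real" where
  "prob_SG Ties_Ignored A B g p =
     \<P>(z in A \<Otimes>\<^sub>M B. correct_guess g p (fst z) (snd z) \<bar> fst z \<noteq> snd z)"
| "prob_SG Ties_Half A B g p =
     \<P>(z in A \<Otimes>\<^sub>M B. correct_guess g p (fst z) (snd z))
       + 1 / 2 * \<P>(z in A \<Otimes>\<^sub>M B. fst z = snd z)"

text \<open>Since the guess at \<open>X = p\<close> is unspecified, both inequalities are required whatever it
  is. When \<open>X = p\<close> has probability zero, \<open>g\<close> is irrelevant.\<close>

definition strictly_predicts :: "tie_rule \<Rightarrow> real measure \<Rightarrow> real measure \<Rightarrow> bool" where
  "strictly_predicts t A B \<longleftrightarrow>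
     (\<forall>p. \<forall>g. prob_SG t A B g p \<ge> 1 / 2) \<and> (\<exists>p. \<forall>g. prob_SG t A B g p > 1 / 2)"

text \<open>Every two outcomes of \<open>A\<close> are separated by an outcome of \<open>B\<close> of non-zero probability.\<close>

definition has_atoms_between_outcomes :: "real measure \<Rightarrow> real measure \<Rightarrow> bool" where
  "has_atoms_between_outcomes B A \<longleftrightarrow>
     (\<forall>a\<in>outcomes A. \<forall>a'\<in>outcomes A. a < a' \<longrightarrow>
        (\<exists>b\<in>outcomes B. a < b \<and> b < a' \<and> measure B {b} > 0))"

definition some_outcome_between :: "real measure \<Rightarrow> real measure \<Rightarrow> bool" where
  "some_outcome_between A B \<longleftrightarrow>
     (\<exists>a\<in>outcomes A. \<exists>b\<in>outcomes B. \<exists>b'\<in>outcomes B. b < a \<and> a < b')"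

definition interwoven :: "real measure \<Rightarrow> real measure \<Rightarrow> bool" where
  "interwoven A B \<longleftrightarrow> some_outcome_between A B \<and> some_outcome_between B A"

end

theory Submission
  imports Defs
begin

text \<open>Let \<open>q x = E sgn (x - Y)\<close>, a non-decreasing function of \<open>x\<close>. Guessing ``\<open>X > Y\<close>'' exactly on
  the upper set \<open>G\<close>, Alice gains \<open>E (\<plusminus> q X)\<close> over a coin flip, up to a positive factor, whatever the
  convention for ties. If \<open>E q X = 0\<close> this gain is \<open>2 E (q X; G)\<close>, which is non-negative because \<open>q\<close>
  is monotone, and positive as soon as \<open>X\<close> has mass below a pointer \<open>p\<close> with \<open>q p < 0\<close>.

  So it suffices to balance: given a law \<open>C\<close> with finitely many outcomes, spread half of the mass of
  \<open>D\<close> uniformly over the midpoints of the pairs of outcomes of \<open>C\<close>, and split the other half between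
  a point below and a point above all outcomes such that \<open>E sgn (X - Y) = 0\<close>. This condition is
  symmetric in the two experiments, so \<open>D\<close> serves as \<open>B\<close> in (a) and as \<open>A\<close> in (b).\<close>

section \<open>The bias of an experiment\<close>

text \<open>For \<open>Y\<close> with law \<open>M\<close> this is P(Y < x) - P(Y > x). An atom at
  \<open>x\<close> contributes zero, so ties are neutral from the start.\<close>

definition bias :: "real measure \<Rightarrow> real \<Rightarrow> real" where
  "bias M x = (\<integral>y. sgn (x - y) \<partial>M)"

context real_distribution
begin

lemma prob_UNIV [simp]: "prob UNIV = 1"
  using prob_space by simp

lemma integrable_sgn_diff [simp]: "integrable M (\<lambda>y. sgn (x - y))"
  by (rule integrable_const_bound[where B=1]) (auto simp: sgn_if)

lemma bias_mono: "x \<le> x' \<Longrightarrow> bias M x \<le> bias M x'"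
  unfolding bias_def
  by (rule integral_mono[OF integrable_sgn_diff integrable_sgn_diff]) (auto simp: sgn_if)

lemma borel_measurable_bias [measurable]: "bias M \<in> borel_measurable borel"
  by (rule borel_measurable_mono) (auto intro: monoI bias_mono)

lemma abs_bias_le_1: "\<bar>bias M x\<bar> \<le> 1"
proof -
  have "norm (bias M x) \<le> (\<integral>y. norm (sgn (x - y)) \<partial>M)"
    unfolding bias_def by (rule integral_norm_bound)
  also have "\<dots> \<le> (\<integral>y. 1 \<partial>M)"
    by (intro integral_mono integrable_norm integrable_sgn_diff) (auto simp: sgn_if)
  finally show ?thesis by simp
qed

lemma integrable_bias:
  assumes "real_distribution N" shows "integrable M (bias N)"
proof -
  interpret N: real_distribution N by fact
  show ?thesis
    by (rule integrable_const_bound[where B=1]) (use N.abs_bias_le_1 in auto)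
qed

text \<open>Integrate the pointwise bound of \<open>sgn (x - y)\<close> by 1 - 2 * indicator of {y >
  x}; mass above \<open>x\<close> makes the resulting bound strict.\<close>

lemma bias_less_1:
  assumes "measure M {x<..} > 0" shows "bias M x < 1"
proof -
  have "integrable M (\<lambda>y. 1 - 2 * indicator {x<..} y :: real)"
    by (auto simp: emeasure_eq_measure)
  then have "bias M x \<le> (\<integral>y. 1 - 2 * indicator {x<..} y \<partial>M)"
    unfolding bias_def by (intro integral_mono[OF integrable_sgn_diff]) (auto simp: sgn_if split: split_indicator)
  also have "\<dots> = 1 - 2 * measure M {x<..}"
    by (subst Bochner_Integration.integral_diff) (auto simp: emeasure_eq_measure)
  finally show ?thesis using assms by simp
qed

lemma bias_greater_minus_1:
  assumes "measure M {..<x} > 0" shows "-1 < bias M x"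
proof -
  have "integrable M (\<lambda>y. 2 * indicator {..<x} y - 1 :: real)"
    by (auto simp: emeasure_eq_measure)
  then have "(\<integral>y. 2 * indicator {..<x} y - 1 \<partial>M) \<le> bias M x"
    unfolding bias_def by (intro integral_mono[OF _ integrable_sgn_diff]) (auto simp: sgn_if split: split_indicator)
  also have "(\<integral>y. 2 * indicator {..<x} y - 1 \<partial>M) = 2 * measure M {..<x} - 1"
    by (subst Bochner_Integration.integral_diff) (auto simp: emeasure_eq_measure)
  finally show ?thesis using assms by simp
qed

end

text \<open>By Fubini and the oddness of \<open>sgn\<close>, both sides are E sgn (X - Y) for
  independent X and Y.\<close>

lemma integral_bias_antisym:
  assumes "real_distribution A" "real_distribution B"
  shows "(\<integral>x. bias B x \<partial>A) = - (\<integral>x. bias A x \<partial>B)"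
proof -
  interpret A: real_distribution A by fact
  interpret B: real_distribution B by fact
  interpret AB: pair_prob_space A B ..
  have int: "integrable (A \<Otimes>\<^sub>M B) (\<lambda>(x, y). sgn (x - y))"
    by (rule AB.P.integrable_const_bound[where B=1]) (auto simp: sgn_if case_prod_beta)
  have "(\<integral>x. bias B x \<partial>A) = (\<integral>y. (\<integral>x. sgn (x - y) \<partial>A) \<partial>B)"
    unfolding bias_def by (rule AB.Fubini_integral[OF int, symmetric])
  also have "\<dots> = (\<integral>y. - bias A y \<partial>B)"
    unfolding bias_def
    by (simp flip: Bochner_Integration.integral_minus add: sgn_minus[symmetric])
  finally show ?thesis by simp
qed

section \<open>Centred experiments predict\<close>

text \<open>Expected payoff when a correct guess pays 1, a wrong one -1 and a tie 0, with Y already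
  integrated out by independence.\<close>

definition gain :: "real measure \<Rightarrow> real measure \<Rightarrow> bool \<Rightarrow> real \<Rightarrow> real" where
  "gain A B g p = (\<integral>x. (if guesses_X_larger g p x then 1 else -1) * bias B x \<partial>A)"

lemma guesses_X_larger_measurable [measurable]: "Measurable.pred borel (guesses_X_larger g p)"
  unfolding guesses_X_larger_def by measurable

lemma prob_correct_guess:
  assumes "real_distribution A" "real_distribution B"
  shows "\<P>(z in A \<Otimes>\<^sub>M B. correct_guess g p (fst z) (snd z)) =
           (\<P>(z in A \<Otimes>\<^sub>M B. fst z \<noteq> snd z) + gain A B g p) / 2"
proof -
  interpret A: real_distribution A by fact
  interpret B: real_distribution B by fact
  interpret AB: pair_prob_space A B ..
  let ?w = "\<lambda>x. if guesses_X_larger g p x then 1 else -1 :: real"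
  let ?C = "{z\<in>space (A \<Otimes>\<^sub>M B). correct_guess g p (fst z) (snd z)}"
  let ?N = "{z\<in>space (A \<Otimes>\<^sub>M B). fst z \<noteq> snd z}"
  have C[measurable]: "?C \<in> sets (A \<Otimes>\<^sub>M B)" and N[measurable]: "?N \<in> sets (A \<Otimes>\<^sub>M B)"
    unfolding correct_guess_def by measurable
  have int: "integrable (A \<Otimes>\<^sub>M B) (\<lambda>z. ?w (fst z) * sgn (fst z - snd z))"
    by (rule AB.P.integrable_const_bound[where B=1]) (auto simp: sgn_if)
  have "gain A B g p = (\<integral>x. (\<integral>y. ?w x * sgn (x - y) \<partial>B) \<partial>A)"
    unfolding gain_def bias_def by simp
  also have "\<dots> = (\<integral>z. ?w (fst z) * sgn (fst z - snd z) \<partial>(A \<Otimes>\<^sub>M B))"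
    using AB.integral_fst'[OF int] by simp
  \<comment> \<open>The payoff is 2 - 1 for a correct guess, 0 - 1 for a wrong one and 0 - 0 for a
    tie, since a correct guess demands a strict inequality.\<close>
  also have "\<dots> = (\<integral>z. 2 * indicator ?C z - indicator ?N z \<partial>(A \<Otimes>\<^sub>M B))"
    by (intro Bochner_Integration.integral_cong)
       (auto simp: sgn_if correct_guess_def split: split_indicator)
  also have "\<dots> = 2 * measure (A \<Otimes>\<^sub>M B) ?C - measure (A \<Otimes>\<^sub>M B) ?N"
    using integrable_real_indicator[OF C] integrable_real_indicator[OF N]
    by (subst Bochner_Integration.integral_diff)
       (auto simp: AB.P.emeasure_eq_measure
         intro!: arg_cong2[where f="\<lambda>a b. 2 * measure _ a - measure _ b"])
  finally show ?thesis by simp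
qed

text \<open>Under either convention the success probability is 1/2 plus a positive multiple of the
  gain, the factor being 1/2 or 1 / (2 P(X \<noteq> Y)).\<close>

lemma strictly_predictsI:
  assumes "real_distribution A" "real_distribution B"
    and nonneg: "\<And>g p. gain A B g p \<ge> 0" and pos: "\<And>g. gain A B g p > 0"
  shows "strictly_predicts t A B"
proof -
  interpret A: real_distribution A by fact
  interpret B: real_distribution B by fact
  interpret AB: pair_prob_space A B ..
  let ?n = "\<P>(z in A \<Otimes>\<^sub>M B. fst z \<noteq> snd z)"
  note correct = prob_correct_guess[OF assms(1,2)]
  have eq: "{z \<in> space (A \<Otimes>\<^sub>M B). fst z = snd z} \<in> sets (A \<Otimes>\<^sub>M B)"
    by measurable
  have neq: "{z \<in> space (A \<Otimes>\<^sub>M B). fst z \<noteq> snd z} \<in> sets (A \<Otimes>\<^sub>M B)"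
    by measurable
  \<comment> \<open>A correct guess excludes a tie, so the gain is at most \<open>?n\<close>.
    Positive gain at the one pointer \<open>p\<close> thus makes the conditioning event
    non-null.\<close>
  have "\<P>(z in A \<Otimes>\<^sub>M B. correct_guess True p (fst z) (snd z)) \<le> ?n"
    by (rule AB.P.finite_measure_mono[OF _ neq]) (auto simp: correct_guess_def split: if_splits)
  then have "gain A B True p \<le> ?n" unfolding correct by simp
  with pos[of True] have n: "?n > 0" by (rule less_le_trans)
  have tie: "\<P>(z in A \<Otimes>\<^sub>M B. fst z = snd z) = 1 - ?n"
    using AB.P.prob_neg[OF eq] by linarith
  have half: "prob_SG Ties_Half A B g p = 1/2 + gain A B g p / 2" for g p
    by (simp add: correct tie field_simps)
  have "\<P>(z in A \<Otimes>\<^sub>M B. correct_guess g p (fst z) (snd z) \<and> fst z \<noteq> snd z) =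
        \<P>(z in A \<Otimes>\<^sub>M B. correct_guess g p (fst z) (snd z))" for g p
    by (rule arg_cong[where f="measure _"]) (auto simp: correct_guess_def)
  then have ign: "prob_SG Ties_Ignored A B g p = 1/2 + gain A B g p / (2 * ?n)" for g p
    using n by (simp add: cond_prob_def correct field_simps)
  show ?thesis
  proof (cases t)
    case Ties_Ignored
    then show ?thesis unfolding strictly_predicts_def
      using n nonneg pos by (auto simp only: ign intro!: exI[of _ p]) (auto)
  next
    case Ties_Half
    then show ?thesis unfolding strictly_predicts_def
      using nonneg pos by (auto simp only: half intro!: exI[of _ p]) (auto)
  qed
qed

lemma strictly_predicts_if_centred:
  assumes "real_distribution A" "real_distribution B"
    and centred: "(\<integral>x. bias B x \<partial>A) = 0"
    and mass: "measure A {..<p} > 0" and neg: "bias B p < 0"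
  shows "strictly_predicts t A B"
proof -
  interpret A: real_distribution A by fact
  interpret B: real_distribution B by fact
  have int: "integrable A (bias B)" by (rule A.integrable_bias) fact
  define up where "up g r = {x. guesses_X_larger g r x}" for g r
  have [measurable]: "up g r \<in> sets borel" for g r
    unfolding up_def by measurable
  have int_up: "integrable A (\<lambda>x. indicator (up g r) x * bias B x)"
      "integrable A (\<lambda>x. indicator (- up g r) x * bias B x)" for g r
    using integrable_mult_indicator[OF _ int, of "up g r"]
      integrable_mult_indicator[OF _ int, of "- up g r"] by auto
  \<comment> \<open>Since E q X = 0, the contributions of the upper set and of its complement are
    opposite, and the gain can be read off from either one alone.\<close>
  have gain_up: "gain A B g r = 2 * (\<integral>x. indicator (up g r) x * bias B x \<partial>A)" for g r
  proof -
    have "gain A B g r = (\<integral>x. 2 * (indicator (up g r) x * bias B x) - bias B x \<partial>A)"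
      unfolding gain_def by (intro Bochner_Integration.integral_cong) (auto simp: up_def)
    then show ?thesis using int int_up by (simp add: centred)
  qed
  have gain_down: "gain A B g r = - 2 * (\<integral>x. indicator (- up g r) x * bias B x \<partial>A)" for g r
  proof -
    have "gain A B g r = (\<integral>x. bias B x - 2 * (indicator (- up g r) x * bias B x) \<partial>A)"
      unfolding gain_def by (intro Bochner_Integration.integral_cong) (auto simp: up_def)
    then show ?thesis using int int_up by (simp add: centred)
  qed
  have nonneg: "gain A B g r \<ge> 0" for g r
  \<comment> \<open>If q is non-negative somewhere off the upper set, monotonicity makes it
    non-negative on all of that set; otherwise q is negative on the whole complement.\<close>
  proof (cases "\<exists>x0. x0 \<notin> up g r \<and> bias B x0 \<ge> 0")
    case True
    then obtain x0 where x0: "x0 \<notin> up g r" "bias B x0 \<ge> 0" by auto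
    have "0 \<le> bias B x" if "x \<in> up g r" for x
      using B.bias_mono[of x0 x] x0 that by (auto simp: up_def guesses_X_larger_def)
    then show ?thesis unfolding gain_up
      by (auto intro!: Bochner_Integration.integral_nonneg split: split_indicator)
  next
    case False
    then have "0 \<le> (\<integral>x. - (indicator (- up g r) x * bias B x) \<partial>A)"
      by (intro Bochner_Integration.integral_nonneg) (auto simp: not_le less_imp_le split: split_indicator)
    then show ?thesis unfolding gain_down by simp
  qed
  have pos: "gain A B g p > 0" for g
  proof -
    \<comment> \<open>On the complement q is at most q p < 0. The point \<open>p\<close> may or may
      not belong to it; dropping it only raises the bound, so the estimate holds for both values of
      \<open>g\<close>.\<close>
    have "bias B p * measure A {..<p} = (\<integral>x. bias B p * indicator {..<p} x \<partial>A)"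
      by simp
    also have "\<dots> \<ge> (\<integral>x. indicator (- up g p) x * bias B x \<partial>A)"
      using int_up neg B.bias_mono[of _ p]
      by (intro integral_mono)
         (auto simp: up_def guesses_X_larger_def A.emeasure_eq_measure less_imp_le split: split_indicator)
    finally have "(\<integral>x. indicator (- up g p) x * bias B x \<partial>A) < 0"
      using mult_neg_pos[OF neg mass] by linarith
    then show ?thesis unfolding gain_down by simp
  qed
  show ?thesis by (rule strictly_predictsI[OF assms(1,2) nonneg pos])
qed

section \<open>Experiments with finitely many outcomes\<close>

text \<open>Each point outside the support has a null ball around it, and by Lindelof countably many
  null open sets cover all such points.\<close>

lemma (in real_distribution) AE_in_outcomes: "AE x in M. x \<in> outcomes M"
proof -
  define \<F> where "\<F> = {S. open S \<and> measure M S = 0}"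
  obtain \<F>' where \<F>': "\<F>' \<subseteq> \<F>" "countable \<F>'" "\<Union>\<F>' = \<Union>\<F>"
    using Lindelof[of \<F>] by (auto simp: \<F>_def)
  have "(\<Union>S\<in>\<F>'. S) \<in> null_sets M"
    using \<F>'(1,2) by (intro null_sets_UN') (auto simp: \<F>_def null_sets_def emeasure_eq_measure)
  then have "\<Union>\<F> \<in> null_sets M" using \<F>'(3) by simp
  then show ?thesis
  proof (rule AE_I')
    show "{x \<in> space M. x \<notin> outcomes M} \<subseteq> \<Union>\<F>"
    proof
      fix x assume "x \<in> {x \<in> space M. x \<notin> outcomes M}"
      then obtain e where "e > 0" "\<not> measure M (ball x e) > 0"
        by (auto simp: outcomes_def)
      then have "x \<in> ball x e" "ball x e \<in> \<F>"
        using measure_nonneg[of M "ball x e"] by (auto simp: \<F>_def)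
      then show "x \<in> \<Union>\<F>" by blast
    qed
  qed
qed

lemma (in real_distribution) measure_open_pos_if_outcome:
  assumes "a \<in> outcomes M" "open S" "a \<in> S"
  shows "measure M S > 0"
proof -
  obtain e where "e > 0" "ball a e \<subseteq> S" using assms openE by blast
  moreover have "measure M (ball a e) \<le> measure M S" if "ball a e \<subseteq> S"
    using that assms(2) by (intro finite_measure_mono) auto
  ultimately show ?thesis using assms(1) by (fastforce simp: outcomes_def)
qed

lemma (in real_distribution) outcome_if_atom:
  assumes "measure M {a} > 0" shows "a \<in> outcomes M"
  unfolding outcomes_def
proof safe
  fix e :: real assume "e > 0"
  then have "measure M {a} \<le> measure M (ball a e)" by (intro finite_measure_mono) auto
  then show "measure M (ball a e) > 0" using assms by linarith
qed

text \<open>The pointer \<open>p\<close> is for the case where \<open>C\<close> is observed,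
  \<open>q\<close> for the case where \<open>D\<close> is observed. Two outcomes of \<open>C\<close>
  guarantee that a midpoint exists.\<close>

lemma ex_balancing_experiment:
  assumes C: "real_distribution C" and fin: "finite (outcomes C)" and card: "card (outcomes C) \<ge> 2"
  obtains D p q where "real_distribution D" "has_atoms_between_outcomes D C" "interwoven D C"
    "(\<integral>x. bias C x \<partial>D) = 0"
    "measure C {..<p} > 0" "bias D p < 0"
    "measure D {..<q} > 0" "bias C q < 0"
proof -
  interpret C: real_distribution C by fact
  define F where "F = outcomes C"
  have F: "finite F" "F \<noteq> {}" using fin card by (auto simp: F_def)
  have MinC: "Min F \<in> outcomes C" and MaxC: "Max F \<in> outcomes C"
    using F Min_in Max_in by (auto simp: F_def)
  \<comment> \<open>The gap of 2 leaves room for the pointer \<open>Min F - 1\<close> strictly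
    between \<open>lo\<close> and the outcomes of \<open>C\<close>.\<close>
  define lo where "lo = Min F - 2"
  define hi where "hi = Max F + 1"
  have below: "bias C x = -1" if "x < Min F" for x
  proof -
    have "bias C x = (\<integral>y. -1 \<partial>C)" unfolding bias_def
    proof (rule integral_cong_AE)
      show "AE y in C. sgn (x - y) = -1"
        using C.AE_in_outcomes
      proof eventually_elim
        case (elim y)
        then have "Min F \<le> y" using F by (simp add: F_def)
        then show ?case using that by simp
      qed
    qed auto
    then show ?thesis by simp
  qed
  have above: "bias C x = 1" if "Max F < x" for x
  proof -
    have "bias C x = (\<integral>y. 1 \<partial>C)" unfolding bias_def
    proof (rule integral_cong_AE)
      show "AE y in C. sgn (x - y) = 1"
        using C.AE_in_outcomes
      proof eventually_elim
        case (elim y)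
        then have "y \<le> Max F" using F by (simp add: F_def)
        then show ?case using that by simp
      qed
    qed auto
    then show ?thesis by simp
  qed
  define mids where "mids = {(a + a') / 2 | a a'. a \<in> F \<and> a' \<in> F \<and> a < a'}"
  have "mids \<subseteq> (\<Union>a\<in>F. (\<lambda>a'. (a + a') / 2) ` F)"
    unfolding mids_def by blast
  then have fin_mids: "finite mids" using F by (meson finite_UN_I finite_imageI finite_subset)
  have "\<not> is_singleton F"
    using card by (auto simp: F_def is_singleton_altdef)
  then have MinMax: "Min F < Max F"
    using F by (metis Max_ge Min_le antisym_conv1 is_singletonI' Min_in order.trans not_le linorder_neqE)
  then have "(Min F + Max F) / 2 \<in> mids"
    unfolding mids_def using Min_in[OF F] Max_in[OF F] by blast
  then have ne_mids: "mids \<noteq> {}" by blast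
  have mids_bounds: "Min F < m \<and> m < Max F" if m: "m \<in> mids" for m
  proof -
    obtain a a' where "a \<in> F" "a' \<in> F" "a < a'" "m = (a + a') / 2"
      using m by (auto simp: mids_def)
    moreover have "Min F \<le> a" "a' \<le> Max F" using calculation F by auto
    ultimately show ?thesis by simp
  qed
  \<comment> \<open>A midpoint has mass of \<open>C\<close> on both sides. The strictness here later
    keeps both outer weights positive.\<close>
  have mids_bias: "-1 < bias C m \<and> bias C m < 1" if "m \<in> mids" for m
    using mids_bounds[OF that] C.measure_open_pos_if_outcome[OF MinC, of "{..<m}"]
      C.measure_open_pos_if_outcome[OF MaxC, of "{m<..}"]
    by (simp add: C.bias_greater_minus_1 C.bias_less_1)
  define \<gamma> where "\<gamma> = (\<Sum>m\<in>mids. bias C m) / card mids"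
  have cardpos: "card mids > 0" using fin_mids ne_mids by (simp add: card_gt_0_iff)
  have "(\<Sum>m\<in>mids. bias C m) < (\<Sum>m\<in>mids. 1)" "(\<Sum>m\<in>mids. -1) < (\<Sum>m\<in>mids. bias C m)"
    using mids_bias by (intro sum_strict_mono fin_mids ne_mids; blast)+
  then have \<gamma>: "-1 < \<gamma>" "\<gamma> < 1"
    using cardpos by (auto simp: \<gamma>_def field_simps)
  \<comment> \<open>With bias -1 at \<open>lo\<close> and 1 at \<open>hi\<close>, balance requires
    \<gamma> - r + (1 - r) = 0; this is its solution.\<close>
  define r where "r = (1 + \<gamma>) / 2"
  have r: "0 < r" "r < 1" using \<gamma> by (auto simp: r_def)
  define outer where "outer = map_pmf (\<lambda>b. if b then lo else hi) (bernoulli_pmf r)"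
  define P where
    "P = bernoulli_pmf (1/2) \<bind> (\<lambda>b. if b then pmf_of_set mids else outer)"
  \<comment> \<open>The push-forward changes only the sigma-algebra, from the discrete one of a pmf
    to the Borel sets.\<close>
  define D where "D = distr (measure_pmf P) borel (\<lambda>x. x)"
  have D: "real_distribution D" unfolding D_def
    by (rule prob_space.real_distribution_distr) (auto intro: prob_space_measure_pmf)
  interpret D: real_distribution D by fact
  have set_outer: "set_pmf outer = {lo, hi}"
    using r by (auto simp: outer_def set_pmf_bernoulli)
  have set_P: "set_pmf P = mids \<union> {lo, hi}"
    unfolding P_def
    by (simp add: set_bind_pmf set_pmf_bernoulli UNIV_bool fin_mids ne_mids set_outer Un_commute)
  \<comment> \<open>\<open>D\<close> gives each midpoint the weight 1 / (2 card mids),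
    \<open>lo\<close> the weight r / 2 and \<open>hi\<close> the weight (1 - r) / 2.\<close>
  have expect: "(\<integral>x. f x \<partial>D) = ((\<Sum>m\<in>mids. f m) / card mids + f lo * r + f hi * (1 - r)) / 2"
    if [measurable]: "f \<in> borel_measurable borel" for f :: "real \<Rightarrow> real"
  proof -
    have "(\<integral>x. f x \<partial>D) = measure_pmf.expectation P f"
      by (simp add: D_def integral_distr)
    also have "\<dots> = (\<Sum>b\<in>UNIV. pmf (bernoulli_pmf (1/2)) b *\<^sub>R
         measure_pmf.expectation (if b then pmf_of_set mids else outer) f)"
      unfolding P_def using fin_mids ne_mids set_outer by (intro pmf_expectation_bind) auto
    also have "\<dots> = ((\<Sum>m\<in>mids. f m) / card mids + f lo * r + f hi * (1 - r)) / 2"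
      using r fin_mids ne_mids
      by (simp add: UNIV_bool integral_pmf_of_set outer_def)
    finally show ?thesis .
  qed
  have atom: "measure D {x} > 0" if "x \<in> mids \<union> {lo, hi}" for x
    using that unfolding set_P[symmetric]
    by (simp add: D_def measure_distr measure_pmf_single pmf_positive)
  have mid_atoms: "m \<in> outcomes D" if "m \<in> mids" for m
    using that atom by (auto intro: D.outcome_if_atom)
  have lo_atom: "lo \<in> outcomes D" using atom by (auto intro: D.outcome_if_atom)
  obtain m where m: "m \<in> mids" using ne_mids by auto
  have "has_atoms_between_outcomes D C"
    unfolding has_atoms_between_outcomes_def F_def[symmetric]
  proof (intro ballI impI)
    fix a a' assume a: "a \<in> F" "a' \<in> F" "a < a'"
    then have "(a + a') / 2 \<in> mids" by (auto simp: mids_def)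
    then show "\<exists>b\<in>outcomes D. a < b \<and> b < a' \<and> measure D {b} > 0"
      using a mid_atoms atom by (intro bexI[of _ "(a + a') / 2"]) auto
  qed
  moreover have "interwoven D C"
    unfolding interwoven_def some_outcome_between_def
  proof
    show "\<exists>a\<in>outcomes D. \<exists>b\<in>outcomes C. \<exists>b'\<in>outcomes C. b < a \<and> a < b'"
      using mid_atoms[OF m] mids_bounds[OF m] MinC MaxC by blast
    have "lo < Min F" by (simp add: lo_def)
    then show "\<exists>a\<in>outcomes C. \<exists>b\<in>outcomes D. \<exists>b'\<in>outcomes D. b < a \<and> a < b'"
      using mid_atoms[OF m] mids_bounds[OF m] MinC lo_atom by blast
  qed
  moreover have "(\<integral>x. bias C x \<partial>D) = 0"
  proof -
    have "bias C lo = -1" "bias C hi = 1"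
      using below[of lo] above[of hi] by (auto simp: lo_def hi_def)
    then show ?thesis
      by (simp add: expect \<gamma>_def[symmetric]) (simp add: r_def field_simps)
  qed
  \<comment> \<open>Above the least outcome of \<open>C\<close> but below every midpoint:
    \<open>lo\<close> is the only atom of \<open>D\<close> to the left of \<open>p\<close>, whence
    the bias (-1 + r - (1 - r)) / 2 = r - 1.\<close>
  moreover define p where "p = (Min F + Min mids) / 2"
  have "Min mids \<in> mids" using fin_mids ne_mids by simp
  then have p: "Min F < p" "p < Min mids" using mids_bounds by (auto simp: p_def)
  then have "measure C {..<p} > 0"
    using MinC by (auto intro: C.measure_open_pos_if_outcome)
  moreover have "bias D p < 0"
  proof -
    have "sgn (p - m) = -1" if "m \<in> mids" for m
      using less_le_trans[OF p(2) Min_le[OF fin_mids that]] by simp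
    then have "(\<Sum>m\<in>mids. sgn (p - m)) = - real (card mids)" by simp
    moreover have "sgn (p - lo) = 1" "sgn (p - hi) = -1"
      using p mids_bounds[OF \<open>Min mids \<in> mids\<close>] by (auto simp: lo_def hi_def)
    ultimately have "bias D p = r - 1"
      unfolding bias_def using cardpos by (subst expect) (auto simp: field_simps)
    then show ?thesis using r by simp
  qed
  \<comment> \<open>The second pointer has \<open>lo\<close> on its left and all outcomes of
    \<open>C\<close> on its right.\<close>
  moreover have "measure D {..<Min F - 1} > 0"
    using lo_atom by (rule D.measure_open_pos_if_outcome) (auto simp: lo_def)
  moreover have "bias C (Min F - 1) < 0" by (subst below) auto
  ultimately show ?thesis using that D by blast
qed

theorem theorem3:
  fixes t :: tie_rule
  shows "(\<forall>A. real_distribution A \<and> finite (outcomes A) \<and> card (outcomes A) \<ge> 2 \<longrightarrow>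
            (\<exists>B. real_distribution B \<and> has_atoms_between_outcomes B A \<and>
                 strictly_predicts t A B))
       \<and> (\<forall>B. real_distribution B \<and> finite (outcomes B) \<and> card (outcomes B) \<ge> 2 \<longrightarrow>
            (\<exists>A. real_distribution A \<and> has_atoms_between_outcomes A B \<and> interwoven A B \<and>
                 strictly_predicts t A B))"
proof (intro conjI allI impI; elim conjE)
  \<comment> \<open>Both claims start from the same hypotheses on the given law, so one
    \<open>C\<close> and one \<open>D\<close> serve for both, with the roles of observed and
    predicted experiment exchanged.\<close>
  fix C :: "real measure"
  assume C: "real_distribution C" "finite (outcomes C)" "card (outcomes C) \<ge> 2"
  obtain D p q where D: "real_distribution D" "has_atoms_between_outcomes D C" "interwoven D C"
    and centred: "(\<integral>x. bias C x \<partial>D) = 0"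
    and p: "measure C {..<p} > 0" "bias D p < 0"
    and q: "measure D {..<q} > 0" "bias C q < 0"
    by (rule ex_balancing_experiment[OF C])
  have "(\<integral>x. bias D x \<partial>C) = 0"
    using integral_bias_antisym[OF C(1) D(1)] centred by simp
  then show "\<exists>B. real_distribution B \<and> has_atoms_between_outcomes B C \<and> strictly_predicts t C B"
    using strictly_predicts_if_centred[OF C(1) D(1) _ p] D by blast
  show "\<exists>A. real_distribution A \<and> has_atoms_between_outcomes A C \<and> interwoven A C \<and>
          strictly_predicts t A C"
    using strictly_predicts_if_centred[OF D(1) C(1) centred q] D by blast
qed

end
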